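(* The class of elementary split matroids is closed under duality, taking minors, and truncation. That is, if $M$ is an elementary split matroid, then its dual $M^*$ is an elementary split matroid, every minor of $M$ is an elementary split matroid, and for every non-negative integer $k$ the $k$-truncation $(M)_k$ is an elementary split matroid.
   Context: All matroids are on finite ground sets; the empty matroid $(\emptyset,\{\emptyset\})$ is allowed. $X-Y$ denotes set difference. A matroid $M$ on ground set $S$ is an elementary split matroid if there exist non-negative integers $r,r_1,\dots,r_q$ ($q\ge0$) with $|S|\ge r$ and a (possibly empty) collection $\mathcal{H}=\{H_1,\dots,H_q\}$ of subsets of $S$ satisfying $|H_i\cap H_j|\le r_i+r_j-r$ for all $1\le i<j\le q$, such that the family of independent sets of $M$ is $\{X\subseteq S\mid |X|\le r,\ |X\cap H_i|\le r_i\text{ for }1\le i\le q\}$. (Such a family always is the family of independent sets of a matroid.) The $k$-truncation of a matroid $M=(S,\mathcal{I})$ is the matroid $(M)_k=(S,\mathcal{I}_k)$ with $\mathcal{I}_k=\{X\in\mathcal{I}\mid |X|\le k\}$. A minor of $M$ is a matroid obtained from $M$ by a sequence of deletions and contractions. *)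

theory Defs
  imports Main
begin

record 'a set_system =
  ground :: "'a set"
  indep :: "'a set set"

definition matroid :: "'a set_system \<Rightarrow> bool" where
  "matroid M \<longleftrightarrow>
     finite (ground M) \<and>
     indep M \<subseteq> Pow (ground M) \<and>
     {} \<in> indep M \<and>
     (\<forall>X\<in>indep M. \<forall>Y. Y \<subseteq> X \<longrightarrow> Y \<in> indep M) \<and>
     (\<forall>X\<in>indep M. \<forall>Y\<in>indep M. card X < card Y \<longrightarrow>
        (\<exists>y\<in>Y - X. insert y X \<in> indep M))"

(* A basis of a subset Z of the ground set: a maximal independent subset of Z. *)
definition basis_of :: "'a set_system \<Rightarrow> 'a set \<Rightarrow> 'a set \<Rightarrow> bool" where
  "basis_of M Z B \<longleftrightarrow>
     B \<in> indep M \<and> B \<subseteq> Z \<and>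
     (\<forall>C\<in>indep M. B \<subseteq> C \<and> C \<subseteq> Z \<longrightarrow> C = B)"

abbreviation basis :: "'a set_system \<Rightarrow> 'a set \<Rightarrow> bool" where
  "basis M B \<equiv> basis_of M (ground M) B"

(* The bases of the dual are exactly the complements of the bases of M. *)
definition dual :: "'a set_system \<Rightarrow> 'a set_system" where
  "dual M = \<lparr> ground = ground M,
              indep = {X. \<exists>B. basis M B \<and> X \<subseteq> ground M - B} \<rparr>"

definition delete :: "'a set_system \<Rightarrow> 'a set \<Rightarrow> 'a set_system" where
  "delete M Z = \<lparr> ground = ground M - Z,
                  indep = {X \<in> indep M. X \<subseteq> ground M - Z} \<rparr>"

(* For a matroid, the choice of the basis B of Z is immaterial. *)
definition contract :: "'a set_system \<Rightarrow> 'a set \<Rightarrow> 'a set_system" where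
  "contract M Z = \<lparr> ground = ground M - Z,
                    indep = {X. X \<subseteq> ground M - Z \<and>
                                (\<exists>B. basis_of M Z B \<and> X \<union> B \<in> indep M)} \<rparr>"

inductive minor :: "'a set_system \<Rightarrow> 'a set_system \<Rightarrow> bool" for M where
  refl: "minor M M"
| delete: "minor M N \<Longrightarrow> Z \<subseteq> ground N \<Longrightarrow> minor M (delete N Z)"
| contract: "minor M N \<Longrightarrow> Z \<subseteq> ground N \<Longrightarrow> minor M (contract N Z)"

definition truncation :: "'a set_system \<Rightarrow> nat \<Rightarrow> 'a set_system" where
  "truncation M k = \<lparr> ground = ground M, indep = {X \<in> indep M. card X \<le> k} \<rparr>"

(* The bound on the intersections is over the integers: its right-hand side may be
   negative, in which case no such pair of hyperedges is allowed. *)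
definition elementary_split :: "'a set_system \<Rightarrow> bool" where
  "elementary_split M \<longleftrightarrow>
     matroid M \<and>
     (\<exists>(r::nat) (q::nat) (rs :: nat \<Rightarrow> nat) (H :: nat \<Rightarrow> 'a set).
        r \<le> card (ground M) \<and>
        (\<forall>i\<in>{1..q}. H i \<subseteq> ground M) \<and>
        (\<forall>i j. 1 \<le> i \<and> i < j \<and> j \<le> q \<longrightarrow>
           int (card (H i \<inter> H j)) \<le> int (rs i) + int (rs j) - int r) \<and>
        indep M = {X. X \<subseteq> ground M \<and> card X \<le> r \<and>
                      (\<forall>i\<in>{1..q}. card (X \<inter> H i) \<le> rs i)})"

end

theory Submission
  imports Defs
begin

text \<open>
  Write \<open>(S, r, H, rs)\<close> for a hypergraph presentation: a family of hyperedges \<open>H i\<close> of a finite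
  set \<open>S\<close> with \<open>card (H i \<inter> H j) \<le> rs i + rs j - r\<close> for \<open>i \<noteq> j\<close>. The crossing condition forces
  every set with fewer than \<open>r\<close> elements to be tight on at most one hyperedge
  (\<open>tight_unique\<close>), and this yields the augmentation property (\<open>feasible_augment\<close>), so that every
  presentation defines a matroid. Each operation then only needs a new presentation.

  \<^item> Lowering \<open>r\<close> weakens the crossing condition. Hence the truncation is presented by lowering \<open>r\<close>
    to \<open>min r k\<close>, and deletion by restricting the hyperedges. The requirement \<open>r \<le> card S\<close> is
    met for free by replacing \<open>r\<close> with \<open>min r (card S)\<close>.

  \<^item> In a contraction by \<open>Z\<close>, a set \<open>X\<close> is independent iff \<open>X \<union> B\<close> is independent in the original
    matroid, for one fixed basis \<open>B\<close> of \<open>Z\<close>. The contraction is therefore presented by the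
    hyperedges \<open>H i - Z\<close> with bounds \<open>rs i - card (B \<inter> H i)\<close> and \<open>r - card B\<close>; the crossing
    condition survives because
    \<open>card (B \<inter> H i) + card (B \<inter> H j) - card B \<le> card (B \<inter> H i \<inter> H j)\<close>.

  \<^item> For the dual, first lower \<open>r\<close> to the rank. Complementing bases turns
    \<open>card (B \<inter> H i) \<le> rs i\<close> into \<open>card ((S - B) - H i) \<le> rs i + card (S - H i) - r\<close>, so that the
    complements of the hyperedges with these bounds and \<open>card S - r\<close> present the dual. That the
    maximal feasible sets of this presentation all have size \<open>card S - r\<close> is again
    \<open>feasible_augment\<close>, applied with the whole ground set as the supply of new elements.
\<close>


section \<open>Hypergraph presentations\<close>

text \<open>
  The hyperedges \<open>H i\<close>, with \<open>i\<close> ranging over an arbitrary index set, satisfy the crossing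
  condition. The relation between \<open>r\<close> and the size of \<open>S\<close> is left open.
\<close>

definition presentation ::
  "'a set \<Rightarrow> nat \<Rightarrow> 'i set \<Rightarrow> ('i \<Rightarrow> 'a set) \<Rightarrow> ('i \<Rightarrow> nat) \<Rightarrow> bool" where
  "presentation S r I H rs \<longleftrightarrow>
     finite S \<and> (\<forall>i\<in>I. H i \<subseteq> S) \<and>
     (\<forall>i\<in>I. \<forall>j\<in>I. i \<noteq> j \<longrightarrow> int (card (H i \<inter> H j)) \<le> int (rs i) + int (rs j) - int r)"

text \<open>The family of sets that a presentation declares to be independent.\<close>

definition feasible ::
  "'a set \<Rightarrow> nat \<Rightarrow> 'i set \<Rightarrow> ('i \<Rightarrow> 'a set) \<Rightarrow> ('i \<Rightarrow> nat) \<Rightarrow> 'a set set" where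
  "feasible S r I H rs =
     {X. X \<subseteq> S \<and> card X \<le> r \<and> (\<forall>i\<in>I. card (X \<inter> H i) \<le> rs i)}"

lemma presentation_mono:
  assumes "presentation S r I H rs" "r' \<le> r"
  shows "presentation S r' I H rs"
  unfolding presentation_def
proof (intro conjI ballI impI)
  show "finite S" "\<And>i. i \<in> I \<Longrightarrow> H i \<subseteq> S" using assms(1) unfolding presentation_def by auto
  fix i j assume "i \<in> I" "j \<in> I" "i \<noteq> j"
  then have "int (card (H i \<inter> H j)) \<le> int (rs i) + int (rs j) - int r"
    using assms(1) unfolding presentation_def by blast
  with assms(2) show "int (card (H i \<inter> H j)) \<le> int (rs i) + int (rs j) - int r'" by linarith
qed

lemma presentation_finite: "presentation S r I H rs \<Longrightarrow> i \<in> I \<Longrightarrow> finite (H i)"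
  unfolding presentation_def by (meson finite_subset)

lemma card_Int_add_le:
  assumes "finite X"
  shows "card (X \<inter> A) + card (X \<inter> B) \<le> card X + card (X \<inter> A \<inter> B)"
proof -
  have "card (X \<inter> A) + card (X \<inter> B) = card ((X \<inter> A) \<union> (X \<inter> B)) + card ((X \<inter> A) \<inter> (X \<inter> B))"
    using assms by (intro card_Un_Int) auto
  moreover have "card ((X \<inter> A) \<union> (X \<inter> B)) \<le> card X"
    using assms by (intro card_mono) auto
  moreover have "(X \<inter> A) \<inter> (X \<inter> B) = X \<inter> A \<inter> B" by blast
  ultimately show ?thesis by simp
qed

lemma tight_unique:
  assumes P: "presentation S r I H rs" and X: "X \<subseteq> S" "card X < r"
    and i: "i \<in> I" "rs i \<le> card (X \<inter> H i)" and j: "j \<in> I" "rs j \<le> card (X \<inter> H j)"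
  shows "i = j"
proof (rule ccontr)
  assume "i \<noteq> j"
  then have cross: "int (card (H i \<inter> H j)) \<le> int (rs i) + int (rs j) - int r"
    using P i(1) j(1) unfolding presentation_def by blast
  have fin: "finite X" "finite (H i)"
    using P X i(1) unfolding presentation_def by (auto intro: finite_subset)
  have "card (X \<inter> H i \<inter> H j) \<le> card (H i \<inter> H j)"
    using fin by (intro card_mono) auto
  with card_Int_add_le[OF fin(1), of "H i" "H j"] cross i(2) j(2) X(2) show False
    by linarith
qed

text \<open>
  The set \<open>T\<close> supplies the new element. It need not be feasible: besides a larger feasible set, the
  whole ground set is a useful choice.
\<close>

lemma feasible_augment:
  assumes P: "presentation S r I H rs" and X: "X \<in> feasible S r I H rs"
    and T: "T \<subseteq> S" and lt: "card X < r" "card X < card T"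
    and room: "\<And>i. i \<in> I \<Longrightarrow> card X < rs i + card (T - H i)"
  shows "\<exists>y\<in>T - X. insert y X \<in> feasible S r I H rs"
proof (rule ccontr)
  assume no: "\<not> ?thesis"
  have XS: "X \<subseteq> S" and finS: "finite S"
    using P X unfolding presentation_def feasible_def by auto
  then have finX: "finite X" and finT: "finite T" using T by (auto intro: finite_subset)
  have tight: "\<exists>i\<in>I. y \<in> H i \<and> card (X \<inter> H i) = rs i" if y: "y \<in> T - X" for y
  proof (rule ccontr)
    assume free: "\<not> ?thesis"
    have "card (insert y X \<inter> H i) \<le> rs i" if i: "i \<in> I" for i
    proof (cases "y \<in> H i")
      case True
      then have "card (X \<inter> H i) < rs i"
        using free X i unfolding feasible_def by fastforce
      then show ?thesis using True finX y by simp
    next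
      case False
      then show ?thesis using X i unfolding feasible_def by simp
    qed
    then have "insert y X \<in> feasible S r I H rs"
      using y T XS lt finX unfolding feasible_def by auto
    with no y show False by blast
  qed
  obtain y0 where y0: "y0 \<in> T - X"
    using card_mono[OF finX, of T] lt(2) by fastforce
  then obtain i where i: "i \<in> I" "card (X \<inter> H i) = rs i" using tight by blast
  \<comment> \<open>every element of \<open>T - X\<close> is blocked by a tight hyperedge, and there is only one\<close>
  have "T - X \<subseteq> H i"
  proof
    fix y assume "y \<in> T - X"
    then obtain j where "j \<in> I" "y \<in> H j" "card (X \<inter> H j) = rs j" using tight by blast
    with tight_unique[OF P XS lt(1), of i j] i show "y \<in> H i" by auto
  qed
  then have "T - H i \<subseteq> X - H i" by blast
  then have "card (T - H i) \<le> card (X - H i)" using finX by (intro card_mono) auto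
  with card_Int_Diff[OF finX, of "H i"] i(2) room[OF i(1)] show False by linarith
qed

lemma matroid_presentation:
  assumes P: "presentation (ground M) r I H rs" and M: "indep M = feasible (ground M) r I H rs"
  shows "matroid M"
  unfolding matroid_def
proof (intro conjI ballI allI impI)
  show fin: "finite (ground M)" using P unfolding presentation_def by simp
  show "indep M \<subseteq> Pow (ground M)" "{} \<in> indep M"
    using M unfolding feasible_def by auto
  show "Y \<in> indep M" if XY: "X \<in> indep M" "Y \<subseteq> X" for X Y
  proof -
    have X: "X \<subseteq> ground M" "card X \<le> r" "\<forall>i\<in>I. card (X \<inter> H i) \<le> rs i"
      using XY M unfolding feasible_def by auto
    have finX: "finite X" using X(1) fin by (rule finite_subset)
    have "card Y \<le> card X" using finX XY(2) by (rule card_mono)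
    moreover have "card (Y \<inter> H i) \<le> card (X \<inter> H i)" for i
      using finX XY(2) by (intro card_mono) auto
    ultimately show ?thesis
      using X XY(2) unfolding M feasible_def by (fastforce intro: order_trans)
  qed
  show "\<exists>y\<in>Y - X. insert y X \<in> indep M"
    if XY: "X \<in> indep M" "Y \<in> indep M" "card X < card Y" for X Y
  proof -
    have Y: "Y \<subseteq> ground M" "card Y \<le> r" "\<forall>i\<in>I. card (Y \<inter> H i) \<le> rs i"
      using XY(2) M unfolding feasible_def by auto
    have finY: "finite Y" using Y(1) fin by (rule finite_subset)
    have "card X < rs i + card (Y - H i)" if "i \<in> I" for i
      using card_Int_Diff[OF finY, of "H i"] Y(3) that XY(3) by fastforce
    then show ?thesis
      using feasible_augment[OF P, of X Y] XY Y M by auto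
  qed
qed

lemma elementary_splitI:
  fixes rs :: "nat \<Rightarrow> nat"
  assumes P: "presentation (ground M) r {1..q} H rs"
    and M: "indep M = feasible (ground M) r {1..q} H rs"
  shows "elementary_split M"
proof -
  define r' where "r' = min r (card (ground M))"
  have fin: "finite (ground M)" using P unfolding presentation_def by simp
  have "r' \<le> r" by (simp add: r'_def)
  from presentation_mono[OF P this] have P': "presentation (ground M) r' {1..q} H rs" .
  have "card X \<le> card (ground M)" if "X \<subseteq> ground M" for X
    using fin that by (rule card_mono)
  then have "indep M = feasible (ground M) r' {1..q} H rs"
    unfolding M feasible_def r'_def by auto
  moreover have "r' \<le> card (ground M)" by (simp add: r'_def)
  ultimately show ?thesis
    using P' matroid_presentation[OF P M]
    unfolding elementary_split_def presentation_def feasible_def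
    by (intro conjI exI[of _ r'] exI[of _ q] exI[of _ rs] exI[of _ H]) auto
qed

lemma elementary_splitE:
  assumes "elementary_split M"
  obtains r q H and rs :: "nat \<Rightarrow> nat"
  where "presentation (ground M) r {1..q} H rs" "indep M = feasible (ground M) r {1..q} H rs"
proof -
  have fin: "finite (ground M)"
    using assms unfolding elementary_split_def matroid_def by simp
  from assms[unfolded elementary_split_def] obtain r q :: nat and rs :: "nat \<Rightarrow> nat" and H where
    *: "r \<le> card (ground M) \<and> (\<forall>i\<in>{1..q}. H i \<subseteq> ground M) \<and>
        (\<forall>i j. 1 \<le> i \<and> i < j \<and> j \<le> q \<longrightarrow>
           int (card (H i \<inter> H j)) \<le> int (rs i) + int (rs j) - int r) \<and>
        indep M = {X. X \<subseteq> ground M \<and> card X \<le> r \<and> (\<forall>i\<in>{1..q}. card (X \<inter> H i) \<le> rs i)}"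
    by (elim conjE exE) (rule that, (rule conjI, assumption)+, assumption)
  then have H: "\<forall>i\<in>{1..q}. H i \<subseteq> ground M" and
    M: "indep M = {X. X \<subseteq> ground M \<and> card X \<le> r \<and> (\<forall>i\<in>{1..q}. card (X \<inter> H i) \<le> rs i)}"
    by simp_all
  have cross: "int (card (H i \<inter> H j)) \<le> int (rs i) + int (rs j) - int r"
    if "1 \<le> i" "i < j" "j \<le> q" for i j
    using * that by blast
  have "int (card (H i \<inter> H j)) \<le> int (rs i) + int (rs j) - int r"
    if ij: "i \<in> {1..q}" "j \<in> {1..q}" "i \<noteq> j" for i j
  proof (cases "i < j")
    case True
    then show ?thesis using cross[of i j] ij by simp
  next
    case False
    then show ?thesis using cross[of j i] ij by (simp add: Int_commute add.commute)
  qed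
  then have "presentation (ground M) r {1..q} H rs"
    using fin H unfolding presentation_def by (intro conjI ballI impI) simp_all
  moreover have "indep M = feasible (ground M) r {1..q} H rs" using M unfolding feasible_def .
  ultimately show ?thesis by (rule that)
qed


section \<open>Bases of matroids\<close>

lemma matroid_augment:
  assumes "matroid M" "X \<in> indep M" "Y \<in> indep M" "card X < card Y"
  obtains y where "y \<in> Y - X" "insert y X \<in> indep M"
proof -
  from assms(1) have "\<forall>X\<in>indep M. \<forall>Y\<in>indep M. card X < card Y \<longrightarrow>
      (\<exists>y\<in>Y - X. insert y X \<in> indep M)"
    unfolding matroid_def by (elim conjE)
  then have "\<exists>y\<in>Y - X. insert y X \<in> indep M" using assms(2-4) by simp
  then show thesis using that by blast
qed

lemma matroid_subset:
  assumes "matroid M" "X \<in> indep M" "Y \<subseteq> X"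
  shows "Y \<in> indep M"
proof -
  from assms(1) have "\<forall>X\<in>indep M. \<forall>Y. Y \<subseteq> X \<longrightarrow> Y \<in> indep M"
    unfolding matroid_def by (elim conjE)
  then show ?thesis using assms(2,3) by blast
qed

lemma indep_finite:
  assumes "matroid M" "X \<in> indep M"
  shows "finite X"
proof -
  have "finite (ground M)" "X \<subseteq> ground M" using assms unfolding matroid_def by auto
  then show ?thesis by (rule finite_subset[rotated])
qed

lemma card_le_basis_of:
  assumes M: "matroid M" and B: "basis_of M Z B" and X: "X \<in> indep M" "X \<subseteq> Z"
  shows "card X \<le> card B"
proof (rule ccontr)
  assume "\<not> ?thesis"
  moreover have "B \<in> indep M" using B unfolding basis_of_def by simp
  ultimately obtain y where "y \<in> X - B" "insert y B \<in> indep M"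
    using matroid_augment[OF M, of B X] X by auto
  then show False using B X(2) unfolding basis_of_def by blast
qed

lemma basis_of_exists:
  assumes M: "matroid M"
  obtains B where "basis_of M Z B"
proof -
  let ?F = "{X \<in> indep M. X \<subseteq> Z}"
  have "finite ?F" "{} \<in> ?F"
    using M unfolding matroid_def by (auto intro: finite_subset)
  then obtain B where "B \<in> ?F" "\<forall>C\<in>?F. B \<subseteq> C \<longrightarrow> B = C"
    using finite_has_maximal[of ?F] by blast
  then have "basis_of M Z B" unfolding basis_of_def by auto
  then show thesis by (rule that)
qed

lemma indep_extend_within:
  assumes M: "matroid M" and X: "X \<in> indep M" and Y: "Y \<in> indep M" and le: "card X \<le> card Y"
  obtains W where "W \<in> indep M" "X \<subseteq> W" "W \<subseteq> X \<union> Y" "card W = card Y"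
proof -
  have "\<exists>W. W \<in> indep M \<and> X \<subseteq> W \<and> W \<subseteq> X \<union> Y \<and> card W = card Y"
    using X le
  proof (induction "card Y - card X" arbitrary: X)
    case 0
    then show ?case by (intro exI[of _ X]) auto
  next
    case (Suc n)
    then have "card X < card Y" by simp
    from matroid_augment[OF M Suc.prems(1) Y this]
    obtain y where y: "y \<in> Y - X" "insert y X \<in> indep M" .
    have "card (insert y X) = Suc (card X)"
      using y(1) indep_finite[OF M Suc.prems(1)] by simp
    then have "n = card Y - card (insert y X)" "card (insert y X) \<le> card Y"
      using Suc.hyps(2) by linarith+
    from Suc.hyps(1)[OF this(1) y(2) this(2)] obtain W where
      "W \<in> indep M \<and> insert y X \<subseteq> W \<and> W \<subseteq> insert y X \<union> Y \<and> card W = card Y" by blast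
    then show ?case using y(1) by (intro exI[of _ W]) auto
  qed
  then show thesis using that by blast
qed

text \<open>In a contraction, the basis of the contracted set can be exchanged for any other one.\<close>

lemma basis_of_exchange:
  assumes M: "matroid M" and B: "basis_of M Z B" and C: "basis_of M Z C"
    and X: "X \<inter> Z = {}" "X \<union> B \<in> indep M"
  shows "X \<union> C \<in> indep M"
proof -
  have BZ: "B \<in> indep M" "B \<subseteq> Z" and CZ: "C \<in> indep M" "C \<subseteq> Z"
    using B C unfolding basis_of_def by auto
  have eq: "card B = card C"
    using card_le_basis_of[OF M B CZ] card_le_basis_of[OF M C BZ] by simp
  have fin: "finite (X \<union> B)" "finite C"
    using indep_finite[OF M] X(2) CZ(1) by auto
  have XB: "card (X \<union> B) = card X + card B"
    using fin X(1) BZ by (intro card_Un_disjoint) auto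
  then have "card C \<le> card (X \<union> B)" using eq by simp
  from indep_extend_within[OF M CZ(1) X(2) this] obtain W where
    W: "W \<in> indep M" "C \<subseteq> W" "W \<subseteq> C \<union> (X \<union> B)" "card W = card (X \<union> B)" .
  have "W \<inter> Z \<in> indep M" using matroid_subset[OF M W(1)] by blast
  moreover have "C \<subseteq> W \<inter> Z" "W \<inter> Z \<subseteq> Z" using W(2) CZ(2) by auto
  ultimately have "W \<inter> Z = C" using C unfolding basis_of_def by simp
  then have sub: "W \<subseteq> X \<union> C" using W(3) BZ(2) by blast
  have "card (X \<union> C) \<le> card W"
    using card_Un_le[of X C] XB eq W(4) by simp
  then have "W = X \<union> C" using sub fin by (intro card_seteq) auto
  with W(1) show ?thesis by simp
qed


section \<open>Truncation and minors\<close>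

lemma elementary_split_truncation:
  assumes "elementary_split M"
  shows "elementary_split (truncation M k)"
proof -
  from assms obtain r q H and rs :: "nat \<Rightarrow> nat" where
    P: "presentation (ground M) r {1..q} H rs" and M: "indep M = feasible (ground M) r {1..q} H rs"
    by (rule elementary_splitE)
  have "presentation (ground M) (min r k) {1..q} H rs"
    using P by (rule presentation_mono) simp
  moreover have "indep (truncation M k) = feasible (ground M) (min r k) {1..q} H rs"
    unfolding truncation_def using M by (auto simp: feasible_def)
  ultimately show ?thesis
    by (intro elementary_splitI[of _ "min r k" q H rs]) (simp_all add: truncation_def)
qed

lemma elementary_split_delete:
  assumes "elementary_split M"
  shows "elementary_split (delete M Z)"
proof -
  from assms obtain r q H and rs :: "nat \<Rightarrow> nat" where
    P: "presentation (ground M) r {1..q} H rs" and M: "indep M = feasible (ground M) r {1..q} H rs"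
    by (rule elementary_splitE)
  let ?S = "ground M - Z" and ?H = "\<lambda>i. H i - Z"
  have P': "presentation ?S r {1..q} ?H rs"
    unfolding presentation_def
  proof (intro conjI ballI impI)
    show "finite ?S" using P unfolding presentation_def by simp
    show "?H i \<subseteq> ?S" if "i \<in> {1..q}" for i using P that unfolding presentation_def by blast
    fix i j assume ij: "i \<in> {1..q}" "j \<in> {1..q}" "i \<noteq> j"
    have "int (card (H i \<inter> H j)) \<le> int (rs i) + int (rs j) - int r"
      using P ij unfolding presentation_def by blast
    moreover have "card (?H i \<inter> ?H j) \<le> card (H i \<inter> H j)"
      using presentation_finite[OF P ij(1)] by (intro card_mono) auto
    ultimately show "int (card (?H i \<inter> ?H j)) \<le> int (rs i) + int (rs j) - int r"
      by linarith
  qed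
  have "X \<inter> ?H i = X \<inter> H i" if "X \<subseteq> ?S" for X i using that by blast
  then have "indep (delete M Z) = feasible ?S r {1..q} ?H rs"
    unfolding delete_def M feasible_def by auto
  with P' show ?thesis
    by (intro elementary_splitI[of _ r q ?H rs]) (simp_all add: delete_def)
qed

lemma elementary_split_contract:
  assumes E: "elementary_split M"
  shows "elementary_split (contract M Z)"
proof -
  from E obtain r q H and rs :: "nat \<Rightarrow> nat" where
    P: "presentation (ground M) r {1..q} H rs" and M: "indep M = feasible (ground M) r {1..q} H rs"
    by (rule elementary_splitE)
  have mat: "matroid M" using E unfolding elementary_split_def by simp
  obtain B where B: "basis_of M Z B" using basis_of_exists[OF mat] .
  then have BZ: "B \<in> indep M" "B \<subseteq> Z" unfolding basis_of_def by auto
  have finB: "finite B" using indep_finite[OF mat BZ(1)] .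
  have B_le: "card B \<le> r" "\<And>i. i \<in> {1..q} \<Longrightarrow> card (B \<inter> H i) \<le> rs i" and BS: "B \<subseteq> ground M"
    using BZ(1) M unfolding feasible_def by auto
  let ?S = "ground M - Z" and ?H = "\<lambda>i. H i - Z"
  let ?r = "r - card B" and ?rs = "\<lambda>i. rs i - card (B \<inter> H i)"
  have P': "presentation ?S ?r {1..q} ?H ?rs"
    unfolding presentation_def
  proof (intro conjI ballI impI)
    show "finite ?S" using P unfolding presentation_def by simp
    show "?H i \<subseteq> ?S" if "i \<in> {1..q}" for i using P that unfolding presentation_def by blast
    fix i j assume ij: "i \<in> {1..q}" "j \<in> {1..q}" "i \<noteq> j"
    have cross: "int (card (H i \<inter> H j)) \<le> int (rs i) + int (rs j) - int r"
      using P ij unfolding presentation_def by blast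
    have fin: "finite (H i \<inter> H j)" using presentation_finite[OF P ij(1)] by simp
    have "card (?H i \<inter> ?H j) + card (B \<inter> H i \<inter> H j) = card ((?H i \<inter> ?H j) \<union> (B \<inter> H i \<inter> H j))"
      using BZ(2) fin finB
      by (intro card_Un_disjoint[symmetric]) (auto intro: finite_subset[OF _ fin])
    also have "\<dots> \<le> card (H i \<inter> H j)" using fin by (intro card_mono) auto
    finally show "int (card (?H i \<inter> ?H j)) \<le> int (?rs i) + int (?rs j) - int ?r"
      using cross card_Int_add_le[OF finB, of "H i" "H j"] B_le(1) B_le(2)[OF ij(1)]
        B_le(2)[OF ij(2)] by linarith
  qed
  have ind: "X \<union> B \<in> indep M \<longleftrightarrow> X \<in> feasible ?S ?r {1..q} ?H ?rs" if X: "X \<subseteq> ?S" for X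
  proof -
    have finX: "finite X"
      using X P unfolding presentation_def by (auto intro: finite_subset)
    have "card (X \<union> B) = card X + card B"
      using finX finB X BZ(2) by (intro card_Un_disjoint) auto
    then have r: "card (X \<union> B) \<le> r \<longleftrightarrow> card X \<le> ?r" using B_le(1) by linarith
    have "card ((X \<union> B) \<inter> H i) \<le> rs i \<longleftrightarrow> card (X \<inter> ?H i) \<le> ?rs i" if i: "i \<in> {1..q}" for i
    proof -
      have "(X \<union> B) \<inter> H i = (X \<inter> ?H i) \<union> (B \<inter> H i)" using X by blast
      also have "card \<dots> = card (X \<inter> ?H i) + card (B \<inter> H i)"
        using finX finB X BZ(2) by (intro card_Un_disjoint) auto
      finally show ?thesis using B_le(2)[OF i] by linarith
    qed
    with r X BS show ?thesis unfolding M feasible_def by auto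
  qed
  have "(\<exists>C. basis_of M Z C \<and> X \<union> C \<in> indep M) \<longleftrightarrow> X \<union> B \<in> indep M" if "X \<subseteq> ?S" for X
    using basis_of_exchange[OF mat _ B, of _ X] B that by blast
  then have "indep (contract M Z) = {X. X \<subseteq> ?S \<and> X \<union> B \<in> indep M}"
    unfolding contract_def by auto
  also have "\<dots> = feasible ?S ?r {1..q} ?H ?rs"
    using ind by (auto simp: feasible_def)
  finally show ?thesis
    using P' by (intro elementary_splitI[of _ ?r q ?H ?rs]) (simp_all add: contract_def)
qed

lemma elementary_split_minor:
  assumes "minor M N" "elementary_split M"
  shows "elementary_split N"
  using assms
proof (induction rule: minor.induct)
  case refl
  then show ?case .
next
  case (delete N Z)
  then show ?case by (intro elementary_split_delete)
next
  case (contract N Z)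
  then show ?case by (intro elementary_split_contract)
qed


section \<open>Duality\<close>

text \<open>The two numerical conditions make all maximal feasible sets have exactly \<open>r\<close> elements.\<close>

lemma feasible_extend:
  assumes P: "presentation S r I H rs" and r: "r \<le> card S"
    and room: "\<And>i. i \<in> I \<Longrightarrow> r \<le> rs i + card (S - H i)"
    and X: "X \<in> feasible S r I H rs"
  obtains Y where "Y \<in> feasible S r I H rs" "X \<subseteq> Y" "card Y = r"
proof -
  have "\<exists>Y. Y \<in> feasible S r I H rs \<and> X \<subseteq> Y \<and> card Y = r"
    using X
  proof (induction "r - card X" arbitrary: X)
    case 0
    then show ?case unfolding feasible_def by (intro exI[of _ X]) auto
  next
    case (Suc n)
    then have lt: "card X < r" by simp
    then have "card X < rs i + card (S - H i)" if "i \<in> I" for i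
      using room[OF that] by simp
    with lt r obtain y where y: "y \<in> S - X" "insert y X \<in> feasible S r I H rs"
      using feasible_augment[OF P Suc.prems, of S] by auto
    have "finite X"
      using P Suc.prems unfolding presentation_def feasible_def by (auto intro: finite_subset)
    then have "card (insert y X) = Suc (card X)" using y(1) by simp
    then have "n = r - card (insert y X)" using Suc.hyps(2) by linarith
    from Suc.hyps(1)[OF this y(2)] obtain Y where
      "Y \<in> feasible S r I H rs \<and> insert y X \<subseteq> Y \<and> card Y = r" by blast
    then show ?case by blast
  qed
  then show thesis using that by blast
qed

lemma elementary_split_dual:
  assumes E: "elementary_split M"
  shows "elementary_split (dual M)"
proof -
  from E obtain r0 q H and rs :: "nat \<Rightarrow> nat" where
    P0: "presentation (ground M) r0 {1..q} H rs"
    and M0: "indep M = feasible (ground M) r0 {1..q} H rs"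
    by (rule elementary_splitE)
  have mat: "matroid M" using E unfolding elementary_split_def by simp
  let ?S = "ground M"
  have finS: "finite ?S" using mat unfolding matroid_def by simp
  obtain B0 where B0: "basis M B0" using basis_of_exists[OF mat] .
  then have B0_ind: "B0 \<in> indep M" unfolding basis_of_def by simp
  \<comment> \<open>the presentation may have too large a bound; it is lowered to the rank\<close>
  define r where "r = card B0"
  have ind_sub: "X \<subseteq> ?S" if "X \<in> indep M" for X using that mat unfolding matroid_def by blast
  have rank: "card X \<le> r" if "X \<in> indep M" for X
    using card_le_basis_of[OF mat B0 that ind_sub[OF that]] by (simp add: r_def)
  have "r \<le> r0" using B0_ind unfolding M0 feasible_def r_def by simp
  with P0 have P: "presentation ?S r {1..q} H rs" by (rule presentation_mono)
  have M: "indep M = feasible ?S r {1..q} H rs"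
    using rank \<open>r \<le> r0\<close> unfolding M0 by (fastforce simp: feasible_def)
  have rS: "r \<le> card ?S" unfolding r_def using finS ind_sub[OF B0_ind] by (rule card_mono)
  have H: "H i \<subseteq> ?S" if "i \<in> {1..q}" for i using P that unfolding presentation_def by blast
  have room: "r \<le> rs i + card (?S - H i)" if "i \<in> {1..q}" for i
  proof -
    have "card (B0 - H i) \<le> card (?S - H i)"
      using ind_sub[OF B0_ind] finS by (intro card_mono) auto
    moreover have "card (B0 \<inter> H i) \<le> rs i"
      using B0_ind that unfolding M feasible_def by blast
    ultimately show ?thesis
      using card_Int_Diff[OF indep_finite[OF mat B0_ind], of "H i"] by (simp add: r_def)
  qed
  have basis_iff: "basis M B \<longleftrightarrow> B \<in> indep M \<and> card B = r" for B
  proof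
    assume B: "basis M B"
    then have "B \<in> indep M" unfolding basis_of_def by simp
    with card_le_basis_of[OF mat B B0_ind ind_sub[OF B0_ind]] rank[of B]
    show "B \<in> indep M \<and> card B = r" by (simp add: r_def)
  next
    assume B: "B \<in> indep M \<and> card B = r"
    have "C = B" if "C \<in> indep M" "B \<subseteq> C" for C
      using card_seteq[OF indep_finite[OF mat that(1)] that(2)] rank[OF that(1)] B by simp
    then show "basis M B" using B ind_sub unfolding basis_of_def by blast
  qed
  let ?r = "card ?S - r" and ?H = "\<lambda>i. ?S - H i" and ?rs = "\<lambda>i. rs i + card (?S - H i) - r"
  have cardS: "card ?S = card (H i) + card (?S - H i)" if "i \<in> {1..q}" for i
    using card_Int_Diff[OF finS, of "H i"] H[OF that] by (simp add: Int_absorb1)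
  have P': "presentation ?S ?r {1..q} ?H ?rs"
    unfolding presentation_def
  proof (intro conjI ballI impI)
    show "finite ?S" by (rule finS)
    show "?H i \<subseteq> ?S" for i by blast
    fix i j assume ij: "i \<in> {1..q}" "j \<in> {1..q}" "i \<noteq> j"
    have cross: "int (card (H i \<inter> H j)) \<le> int (rs i) + int (rs j) - int r"
      using P ij unfolding presentation_def by blast
    have fin: "finite (H i)" "finite (H j)"
      using presentation_finite[OF P ij(1)] presentation_finite[OF P ij(2)] .
    have inter: "?H i \<inter> ?H j = ?S - (H i \<union> H j)" by blast
    have "H i \<union> H j \<subseteq> ?S" using H ij by blast
    then have "card ?S = card (H i \<union> H j) + card (?S - (H i \<union> H j))"
      using card_Int_Diff[OF finS, of "H i \<union> H j"] by (simp add: Int_absorb1)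
    moreover have "card (H i) + card (H j) = card (H i \<union> H j) + card (H i \<inter> H j)"
      using fin by (rule card_Un_Int)
    ultimately show "int (card (?H i \<inter> ?H j)) \<le> int (?rs i) + int (?rs j) - int ?r"
      using cross cardS[OF ij(1)] cardS[OF ij(2)] room[OF ij(1)] room[OF ij(2)] rS
      unfolding inter by linarith
  qed
  have compl: "Y \<in> feasible ?S ?r {1..q} ?H ?rs \<longleftrightarrow> ?S - Y \<in> indep M"
    if Y: "Y \<subseteq> ?S" "card Y = ?r" for Y
  proof -
    have finY: "finite Y" using Y(1) finS by (rule finite_subset)
    have cY: "card (?S - Y) = r"
      using card_Diff_subset[OF finY Y(1)] Y(2) rS by simp
    have "card (Y \<inter> ?H i) \<le> ?rs i \<longleftrightarrow> card ((?S - Y) \<inter> H i) \<le> rs i" if i: "i \<in> {1..q}" for i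
    proof -
      have "card (?S - H i) = card ((?S - H i) \<inter> Y) + card ((?S - H i) - Y)"
        using finS by (intro card_Int_Diff) simp
      moreover have "(?S - H i) \<inter> Y = Y \<inter> ?H i" "(?S - H i) - Y = (?S - Y) - H i" by auto
      ultimately have "card (?S - H i) = card (Y \<inter> ?H i) + card ((?S - Y) - H i)" by simp
      moreover have "r = card ((?S - Y) \<inter> H i) + card ((?S - Y) - H i)"
        using card_Int_Diff[of "?S - Y" "H i"] finS cY by simp
      ultimately show ?thesis using room[OF i] by linarith
    qed
    then show ?thesis unfolding M feasible_def using Y cY by auto
  qed
  have extends: "\<exists>Y. Y \<in> feasible ?S ?r {1..q} ?H ?rs \<and> X \<subseteq> Y \<and> card Y = ?r"
    if X: "X \<in> feasible ?S ?r {1..q} ?H ?rs" for X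
  proof -
    have "?r \<le> ?rs i + card (?S - ?H i)" if i: "i \<in> {1..q}" for i
    proof -
      have "?S - ?H i = H i" using H[OF i] by blast
      then show ?thesis using cardS[OF i] room[OF i] by simp
    qed
    from feasible_extend[OF P' diff_le_self this X] show ?thesis by blast
  qed
  let ?D = "\<lparr>ground = ?S, indep = feasible ?S ?r {1..q} ?H ?rs\<rparr>"
  have matD: "matroid ?D"
    using P' by (intro matroid_presentation[of _ ?r "{1..q}" ?H ?rs]) simp_all
  have "X \<in> indep (dual M) \<longleftrightarrow> X \<in> feasible ?S ?r {1..q} ?H ?rs" for X
  proof
    assume "X \<in> indep (dual M)"
    then obtain B where B: "basis M B" "X \<subseteq> ?S - B" unfolding dual_def by auto
    then have BM: "B \<in> indep M" "card B = r" using basis_iff by auto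
    then have "card (?S - B) = ?r"
      using card_Diff_subset[OF indep_finite[OF mat BM(1)] ind_sub[OF BM(1)]] by simp
    moreover have "?S - (?S - B) = B" using ind_sub[OF BM(1)] by blast
    ultimately have "?S - B \<in> feasible ?S ?r {1..q} ?H ?rs"
      using compl[of "?S - B"] BM(1) by auto
    then show "X \<in> feasible ?S ?r {1..q} ?H ?rs"
      using matroid_subset[OF matD, of "?S - B" X] B(2) by simp
  next
    assume "X \<in> feasible ?S ?r {1..q} ?H ?rs"
    then obtain Y where Y: "Y \<in> feasible ?S ?r {1..q} ?H ?rs" "X \<subseteq> Y" "card Y = ?r"
      using extends by blast
    have YS: "Y \<subseteq> ?S" using Y(1) unfolding feasible_def by simp
    have "card (?S - Y) = r"
      using card_Diff_subset[OF finite_subset[OF YS finS] YS] Y(3) rS by simp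
    moreover have "?S - Y \<in> indep M" using compl[OF YS Y(3)] Y(1) by simp
    ultimately have "basis M (?S - Y)" using basis_iff by blast
    moreover have "X \<subseteq> ?S - (?S - Y)" using Y(2) YS by blast
    ultimately show "X \<in> indep (dual M)" unfolding dual_def by auto
  qed
  then have "indep (dual M) = feasible ?S ?r {1..q} ?H ?rs" by blast
  with P' show ?thesis
    by (intro elementary_splitI[of _ ?r q ?H ?rs]) (simp_all add: dual_def)
qed

theorem theorem8:
  fixes M :: "'a set_system"
  assumes "elementary_split M"
  shows "elementary_split (dual M) \<and>
         (\<forall>N. minor M N \<longrightarrow> elementary_split N) \<and>
         (\<forall>k::nat. elementary_split (truncation M k))"
proof (intro conjI allI impI)
  show "elementary_split (dual M)" using assms by (rule elementary_split_dual)
  show "elementary_split N" if "minor M N" for N using that assms by (rule elementary_split_minor)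
  show "elementary_split (truncation M k)" for k
    using assms by (rule elementary_split_truncation)
qed

end
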